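(* There exist absolute constants $c>0$ and $C>0$ such that the following holds. For every integer $n\ge1$ and all parameters $0<\varepsilon_2\le 1$ and $0\le \varepsilon_1\le c\,\varepsilon_2$, there is a tester which, given \[ m\le C\left( n\Big(\frac{\varepsilon_1}{\varepsilon_2^2}\Big)^2+n\,\frac{\varepsilon_1}{\varepsilon_2^2}+\frac{\sqrt n}{\varepsilon_2^{2}} +\frac{n^{2/3}}{\varepsilon_2^{4/3}} \right) \] independent samples from each of two unknown distributions $p$ and $q$ over $[n]$, distinguishes between $\|p-q\|_1\le \varepsilon_1$ and $\|p-q\|_1\ge \varepsilon_2$ with probability at least $4/5$.
   Context: $[n]=\{1,\dots,n\}$; distributions over $[n]$ are probability vectors; $\|p-q\|_1=\sum_i|p_i-q_i|$. "Distinguishes with probability at least $4/5$" means: outputs "close" with probability $\ge4/5$ whenever $\|p-q\|_1\le\varepsilon_1$ and "far" with probability $\ge 4/5$ whenever $\|p-q\|_1\ge\varepsilon_2$. *)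

theory Defs
  imports "HOL-Probability.Probability"
begin

definition dist_on :: "nat \<Rightarrow> nat pmf \<Rightarrow> bool" where
  "dist_on n p \<longleftrightarrow> set_pmf p \<subseteq> {1..n}"

definition l1_dist :: "nat \<Rightarrow> nat pmf \<Rightarrow> nat pmf \<Rightarrow> real" where
  "l1_dist n p q = (\<Sum>i\<in>{1..n}. \<bar>pmf p i - pmf q i\<bar>)"

definition samples :: "nat \<Rightarrow> nat pmf \<Rightarrow> (nat \<Rightarrow> nat) pmf" where
  "samples m p = Pi_pmf {..<m} 0 (\<lambda>_. p)"

text \<open>A (randomized) tester maps the two sample sequences to a distribution on
  outputs; True means "far", False means "close".  Output distribution when run on
  m independent samples from each of p and q:\<close>
definition run_tester ::
  "nat \<Rightarrow> ((nat \<Rightarrow> nat) \<Rightarrow> (nat \<Rightarrow> nat) \<Rightarrow> bool pmf) \<Rightarrow> nat pmf \<Rightarrow> nat pmf \<Rightarrow> bool pmf" where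
  "run_tester m T p q = do { xs \<leftarrow> samples m p; ys \<leftarrow> samples m q; T xs ys }"

end

theory Submission
  imports Defs
begin

text \<open>
  Each sample is cut into four batches of size \<open>k\<close>. With \<open>d\<^sub>i = k (p\<^sub>i - q\<^sub>i)\<close> and
  \<open>s\<^sub>i = k (p\<^sub>i + q\<^sub>i)\<close>, two batches estimate a weight \<open>f\<^sub>i\<close> of order
  \<open>1 + |d\<^sub>i| + \<surd>s\<^sub>i\<close>; the other two give independent unbiased estimates of \<open>d\<^sub>i\<close>, whose
  products, divided by \<open>f\<^sub>i\<close> and summed, form the test statistic. Given the weights it has mean
  \<open>\<Sum> d\<^sub>i\<^sup>2 / f\<^sub>i\<close>, and its variance is \<open>O(k)\<close> because \<open>f\<^sub>i\<close> dominates both \<open>|d\<^sub>i|\<close> and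
  \<open>\<surd>s\<^sub>i\<close>. For close distributions the mean is at most of order \<open>\<Sum> |d\<^sub>i| \<le> k \<epsilon>\<^sub>1\<close>; for far
  ones Cauchy-Schwarz bounds it below by \<open>(\<Sum> |d\<^sub>i|)\<^sup>2 / \<Sum> f\<^sub>i\<close>, which is at least of order
  \<open>(k \<epsilon>\<^sub>2)\<^sup>2 / (k \<epsilon>\<^sub>2 + \<surd>(k n) + n)\<close>. Comparing these with each other and with
  \<open>\<surd>k\<close> yields the terms of the sample complexity. Separate batches replace Poissonization.
\<close>

section \<open>Expectations and Markov's inequality for finitely supported distributions\<close>

lemma expectation_dist_on:
  fixes u :: "nat \<Rightarrow> real"
  assumes "dist_on n p"
  shows "measure_pmf.expectation p u = (\<Sum>i\<in>{1..n}. pmf p i * u i)"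
  using assms unfolding dist_on_def
  by (subst integral_measure_pmf_real[of "{1..n}"]) (auto simp: mult.commute)

lemma expectation_pair_pmf:
  fixes f :: "'a \<times> 'b \<Rightarrow> real"
  assumes "finite (set_pmf p)" "finite (set_pmf q)"
  shows "measure_pmf.expectation (pair_pmf p q) f =
    measure_pmf.expectation p (\<lambda>x. measure_pmf.expectation q (\<lambda>y. f (x, y)))"
proof -
  have "measure_pmf.expectation (pair_pmf p q) f =
      (\<Sum>a\<in>set_pmf p. pmf p a * measure_pmf.expectation (q \<bind> (\<lambda>y. return_pmf (a, y))) f)"
    unfolding pair_pmf_def using assms by (subst pmf_expectation_bind[of "set_pmf p"]) auto
  also have "\<dots> = (\<Sum>a\<in>set_pmf p. pmf p a * measure_pmf.expectation q (\<lambda>y. f (a, y)))"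
    unfolding map_pmf_def[symmetric] by simp
  also have "\<dots> = measure_pmf.expectation p (\<lambda>x. measure_pmf.expectation q (\<lambda>y. f (x, y)))"
    using assms by (subst integral_measure_pmf_real[of "set_pmf p"]) (auto simp: mult.commute)
  finally show ?thesis .
qed

lemma expectation_mono_pmf:
  fixes f g :: "'a \<Rightarrow> real"
  assumes "finite (set_pmf p)" "\<And>x. x \<in> set_pmf p \<Longrightarrow> f x \<le> g x"
  shows "measure_pmf.expectation p f \<le> measure_pmf.expectation p g"
  using assms by (intro integral_mono_AE) (auto simp: AE_measure_pmf_iff integrable_measure_pmf_finite)

lemma expectation_sum_pmf:
  fixes f :: "'i \<Rightarrow> 'a \<Rightarrow> real"
  assumes "finite (set_pmf p)"
  shows "measure_pmf.expectation p (\<lambda>x. \<Sum>i\<in>I. f i x) = (\<Sum>i\<in>I. measure_pmf.expectation p (f i))"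
  by (simp add: assms integrable_measure_pmf_finite)

lemma expectation_add_pmf:
  fixes f g :: "'a \<Rightarrow> real"
  assumes "finite (set_pmf p)"
  shows "measure_pmf.expectation p (\<lambda>x. f x + g x) =
    measure_pmf.expectation p f + measure_pmf.expectation p g"
  by (simp add: assms integrable_measure_pmf_finite)

lemma markov_pmf:
  fixes f :: "'a \<Rightarrow> real"
  assumes "finite (set_pmf p)" "\<And>x. 0 \<le> f x" "0 < c" "measure_pmf.expectation p f \<le> b * c"
  shows "measure_pmf.prob p {x. c \<le> f x} \<le> b"
proof -
  have "measure_pmf.prob p {x \<in> space (measure_pmf p). c \<le> f x} \<le> measure_pmf.expectation p f / c"
    using assms by (intro integral_Markov_inequality_measure[where A = "{}"])
      (auto simp: integrable_measure_pmf_finite)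
  also have "\<dots> \<le> b" using assms by (simp add: field_simps)
  finally show ?thesis by simp
qed

lemma finite_set_pmf_dist_on: "dist_on n p \<Longrightarrow> finite (set_pmf p)"
  unfolding dist_on_def by (rule finite_subset) auto

section \<open>Independent sample sequences and sums over them\<close>

lemma
  assumes "xs \<in> set_pmf (samples m p)"
  shows samples_in_support: "j < m \<Longrightarrow> xs j \<in> set_pmf p"
    and samples_outside: "\<not> j < m \<Longrightarrow> xs j = 0"
  using assms unfolding samples_def by (auto simp: set_Pi_pmf PiE_dflt_def)

lemma finite_set_pmf_samples:
  assumes "finite (set_pmf p)" shows "finite (set_pmf (samples m p))"
  unfolding samples_def using assms by (subst set_Pi_pmf) (auto intro: finite_PiE_dflt)

lemma samples_0: "samples 0 p = return_pmf (\<lambda>_. 0)"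
  by (simp add: samples_def)

lemma samples_Suc:
  "samples (Suc m) p = map_pmf (\<lambda>(y, f). f(m := y)) (pair_pmf p (samples m p))"
  unfolding samples_def lessThan_Suc by (rule Pi_pmf_insert) auto

text \<open>Induction on \<open>m\<close>: the added sample is independent of the earlier ones, and
  the cross term of the expanded square vanishes because the earlier sum has mean 0.\<close>

lemma expectation_sum_samples_centered:
  fixes u :: "nat \<Rightarrow> real"
  assumes fin: "finite (set_pmf p)" and mean: "measure_pmf.expectation p u = 0"
  shows "measure_pmf.expectation (samples m p) (\<lambda>xs. \<Sum>j<m. u (xs j)) = 0"
    and "measure_pmf.expectation (samples m p) (\<lambda>xs. (\<Sum>j<m. u (xs j))\<^sup>2) =
      real m * measure_pmf.expectation p (\<lambda>i. (u i)\<^sup>2)"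
proof (induction m)
  case 0
  { case 1 show ?case by (simp add: samples_0) next case 2 show ?case by (simp add: samples_0) }
next
  case (Suc m)
  note fs = finite_set_pmf_samples[OF fin, of m]
  define S where "S = (\<lambda>xs. \<Sum>j<m. u (xs j))"
  have S_upd: "(\<Sum>j<m. u ((f(m := y)) j)) = S f" for f y
    unfolding S_def by (intro sum.cong) auto
  have IH: "measure_pmf.expectation (samples m p) S = 0"
    "measure_pmf.expectation (samples m p) (\<lambda>xs. (S xs)\<^sup>2) =
      real m * measure_pmf.expectation p (\<lambda>i. (u i)\<^sup>2)"
    using Suc by (simp_all add: S_def)
  \<comment> \<open>Stated for an arbitrary \<open>F\<close>, so that the identity and the square
    give both moments from one computation.\<close>
  have step: "measure_pmf.expectation (samples (Suc m) p) (\<lambda>xs. F (\<Sum>j<Suc m. u (xs j))) =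
      measure_pmf.expectation p (\<lambda>y. measure_pmf.expectation (samples m p) (\<lambda>f. F (S f + u y)))"
    for F :: "real \<Rightarrow> real"
  proof -
    have "(\<Sum>j<Suc m. u ((f(m := y)) j)) = S f + u y" for f y
      unfolding S_upd[of f y, symmetric] by simp
    then show ?thesis
      unfolding samples_Suc integral_map_pmf expectation_pair_pmf[OF fin fs] case_prod_unfold fst_conv snd_conv
      by simp
  qed
  { case 1
    show ?case
      unfolding step[of "\<lambda>x. x"] expectation_add_pmf[OF fs] IH by (simp add: mean)
  next
    case 2
    have "measure_pmf.expectation (samples m p) (\<lambda>f. (S f + u y)\<^sup>2) =
        real m * measure_pmf.expectation p (\<lambda>i. (u i)\<^sup>2) + (u y)\<^sup>2" for y
      unfolding power2_sum expectation_add_pmf[OF fs] IH by (simp add: IH)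
    then show ?case
      unfolding step[of "\<lambda>x. x\<^sup>2"] by (simp add: expectation_add_pmf[OF fin] algebra_simps)
  }
qed

section \<open>Occurrence counts and the variance of their linear forms\<close>

definition cnt :: "nat \<Rightarrow> (nat \<Rightarrow> nat) \<Rightarrow> nat \<Rightarrow> real" where
  "cnt k xs i = (\<Sum>j<k. if xs j = i then 1 else 0)"

lemma sum_cnt_samples:
  assumes "dist_on n p" "xs \<in> set_pmf (samples k p)"
  shows "(\<Sum>i\<in>{1..n}. g i * cnt k xs i) = (\<Sum>j<k. g (xs j))"
proof -
  have "(\<Sum>i\<in>{1..n}. g i * cnt k xs i) = (\<Sum>j<k. \<Sum>i\<in>{1..n}. if i = xs j then g i else 0)"
    unfolding cnt_def sum_distrib_left
    by (subst sum.swap) (intro sum.cong refl, auto)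
  also have "\<dots> = (\<Sum>j<k. g (xs j))"
  proof (intro sum.cong refl)
    fix j assume "j \<in> {..<k}"
    then have "xs j \<in> {1..n}" using assms samples_in_support[OF assms(2), of j] by (auto simp: dist_on_def)
    then show "(\<Sum>i\<in>{1..n}. if i = xs j then g i else 0) = g (xs j)" by simp
  qed
  finally show ?thesis .
qed

text \<open>The counts at different indices are dependent, but the form is a sum over the
  \<open>k\<close> independent samples of \<open>g (xs j)\<close> minus its mean. Its second moment
  is therefore \<open>k\<close> times the variance of \<open>g\<close>, and dropping the squared
  mean gives the bound.\<close>

lemma variance_linear_form_cnt:
  assumes p: "dist_on n p"
  shows "measure_pmf.expectation (samples k p)
      (\<lambda>xs. (\<Sum>i\<in>{1..n}. g i * (cnt k xs i - real k * pmf p i))\<^sup>2)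
    \<le> real k * (\<Sum>i\<in>{1..n}. (g i)\<^sup>2 * pmf p i)"
proof -
  note fin = finite_set_pmf_dist_on[OF p]
  define \<mu> where "\<mu> = measure_pmf.expectation p g"
  define u where "u = (\<lambda>i. g i - \<mu>)"
  have mean: "measure_pmf.expectation p u = 0"
    by (simp add: u_def \<mu>_def integrable_measure_pmf_finite fin)
  have \<mu>: "\<mu> = (\<Sum>i\<in>{1..n}. pmf p i * g i)"
    unfolding \<mu>_def by (rule expectation_dist_on[OF p])
  have "measure_pmf.expectation (samples k p)
      (\<lambda>xs. (\<Sum>i\<in>{1..n}. g i * (cnt k xs i - real k * pmf p i))\<^sup>2) =
    measure_pmf.expectation (samples k p) (\<lambda>xs. (\<Sum>j<k. u (xs j))\<^sup>2)"
  proof (intro integral_cong_AE, simp, simp, unfold AE_measure_pmf_iff, intro ballI)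
    fix xs assume xs: "xs \<in> set_pmf (samples k p)"
    have "(\<Sum>i\<in>{1..n}. g i * (cnt k xs i - real k * pmf p i)) =
        (\<Sum>i\<in>{1..n}. g i * cnt k xs i) - real k * \<mu>"
      unfolding \<mu> by (simp add: algebra_simps sum_subtractf sum_distrib_left)
    also have "\<dots> = (\<Sum>j<k. u (xs j))"
      unfolding sum_cnt_samples[OF p xs] by (simp add: u_def sum_subtractf)
    finally show "(\<Sum>i\<in>{1..n}. g i * (cnt k xs i - real k * pmf p i))\<^sup>2 = (\<Sum>j<k. u (xs j))\<^sup>2"
      by simp
  qed
  also have "\<dots> = real k * measure_pmf.expectation p (\<lambda>i. (u i)\<^sup>2)"
    by (rule expectation_sum_samples_centered(2)[OF fin mean])
  also have "measure_pmf.expectation p (\<lambda>i. (u i)\<^sup>2) = measure_pmf.expectation p (\<lambda>i. (g i)\<^sup>2) - \<mu>\<^sup>2"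
    unfolding u_def power2_diff
    by (simp add: integrable_measure_pmf_finite fin \<mu>_def[symmetric])
       (simp add: power2_eq_square)
  also have "real k * \<dots> \<le> real k * measure_pmf.expectation p (\<lambda>i. (g i)\<^sup>2)"
    by (intro mult_left_mono) auto
  also have "measure_pmf.expectation p (\<lambda>i. (g i)\<^sup>2) = (\<Sum>i\<in>{1..n}. (g i)\<^sup>2 * pmf p i)"
    by (subst expectation_dist_on[OF p]) (simp add: mult.commute)
  finally show ?thesis .
qed

section \<open>Cutting samples into independent batches\<close>

lemma split_samples:
  "map_pmf (\<lambda>xs. (\<lambda>j. if j < a then xs j else 0, \<lambda>j. xs (a + j))) (samples (a + b) p) =
    pair_pmf (samples a p) (samples b p)"
proof -
  let ?Q = "Pi_pmf {a..<a + b} 0 (\<lambda>_. p)"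
  have "Pi_pmf ({..<a} \<union> {a..<a + b}) 0 (\<lambda>_. p) =
      map_pmf (\<lambda>(f, g) x. if x \<in> {..<a} then f x else g x) (pair_pmf (samples a p) ?Q)"
    unfolding samples_def by (rule Pi_pmf_union) auto
  also have "{..<a} \<union> {a..<a + b} = {..<a + b}" by auto
  finally have split: "samples (a + b) p =
      map_pmf (\<lambda>(f, g) x. if x \<in> {..<a} then f x else g x) (pair_pmf (samples a p) ?Q)"
    by (simp only: samples_def)
  have "map_pmf (\<lambda>xs. (\<lambda>j. if j < a then xs j else 0, \<lambda>j. xs (a + j))) (samples (a + b) p) =
      map_pmf (\<lambda>(f, g). (\<lambda>j. if j < a then f j else 0, (\<lambda>g j. g (a + j)) g)) (pair_pmf (samples a p) ?Q)"
    unfolding split pmf.map_comp by (intro map_pmf_cong refl) (auto simp: fun_eq_iff)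
  also have "\<dots> = pair_pmf (map_pmf (\<lambda>f j. if j < a then f j else 0) (samples a p))
      (map_pmf (\<lambda>g j. g (a + j)) ?Q)"
    by (rule map_pair)
  \<comment> \<open>Resetting the positions from \<open>a\<close> on changes nothing on the support,
    because 0 is the default value in \<open>samples\<close>.\<close>
  also have "map_pmf (\<lambda>f j. if j < a then f j else 0) (samples a p) = map_pmf (\<lambda>f. f) (samples a p)"
    by (intro map_pmf_cong refl ext) (simp add: samples_outside)
  also have "map_pmf (\<lambda>g j. g (a + j)) ?Q = samples b p"
  proof -
    have "bij_betw (\<lambda>j. a + j) {..<b} {a..<a + b}"
      by (rule bij_betw_byWitness[where f' = "\<lambda>j. j - a"]) auto
    then show ?thesis
      unfolding samples_def by (subst Pi_pmf_bij_betw[of "{..<b}" "\<lambda>j. a + j" "{a..<a + b}"]) (auto simp: o_def)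
  qed
  finally show ?thesis by (simp only: pmf.map_ident)
qed

text \<open>The rearrangement is injective, and both point masses are the product of the same four
  factors. It turns grouping by batch into grouping by distribution, where
  \<open>split_samples\<close> applies to each component.\<close>

lemma pair_pmf_interchange:
  "pair_pmf (pair_pmf A B) (pair_pmf C D) =
    map_pmf (\<lambda>((a, c), (b, d)). ((a, b), (c, d))) (pair_pmf (pair_pmf A C) (pair_pmf B D))"
    (is "?l = map_pmf ?F ?r")
proof (rule pmf_eqI)
  fix z :: "('a \<times> 'b) \<times> ('c \<times> 'd)"
  obtain a b c d where z: "z = ((a, b), (c, d))" by (metis surj_pair)
  have "inj ?F" by (auto simp: inj_def)
  then have "pmf (map_pmf ?F ?r) (?F ((a, c), (b, d))) = pmf ?r ((a, c), (b, d))"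
    by (rule pmf_map_inj')
  then show "pmf ?l z = pmf (map_pmf ?F ?r) z" by (simp add: z pmf_pair)
qed

text \<open>Both sequences are cut at the same place and the result is grouped by batch, so that
  each component is again a pair of samples that can be cut once more.\<close>

definition halves ::
  "nat \<Rightarrow> (nat \<Rightarrow> nat) \<times> (nat \<Rightarrow> nat) \<Rightarrow> ((nat \<Rightarrow> nat) \<times> (nat \<Rightarrow> nat)) \<times> ((nat \<Rightarrow> nat) \<times> (nat \<Rightarrow> nat))"
  where "halves a h = ((\<lambda>j. if j < a then fst h j else 0, \<lambda>j. if j < a then snd h j else 0),
    (\<lambda>j. fst h (a + j), \<lambda>j. snd h (a + j)))"

lemma map_halves:
  "map_pmf (halves a) (pair_pmf (samples (a + b) p) (samples (a + b) q)) =
    pair_pmf (pair_pmf (samples a p) (samples a q)) (pair_pmf (samples b p) (samples b q))"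
proof -
  let ?s = "\<lambda>xs :: nat \<Rightarrow> nat. (\<lambda>j. if j < a then xs j else 0, \<lambda>j. xs (a + j))"
  have "pair_pmf (pair_pmf (samples a p) (samples a q)) (pair_pmf (samples b p) (samples b q)) =
     map_pmf (\<lambda>((a, c), (b, d)). ((a, b), (c, d)))
       (pair_pmf (pair_pmf (samples a p) (samples b p)) (pair_pmf (samples a q) (samples b q)))"
    by (rule pair_pmf_interchange)
  also have "\<dots> = map_pmf (\<lambda>((a, c), (b, d)). ((a, b), (c, d)))
     (map_pmf (\<lambda>(x, y). (?s x, ?s y)) (pair_pmf (samples (a + b) p) (samples (a + b) q)))"
    unfolding map_pair split_samples ..
  also have "\<dots> = map_pmf (halves a) (pair_pmf (samples (a + b) p) (samples (a + b) q))"
    by (simp add: pmf.map_comp o_def halves_def[abs_def] case_prod_unfold)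
  finally show ?thesis ..
qed

section \<open>The weights and the test statistic\<close>

type_synonym sample_pair = "(nat \<Rightarrow> nat) \<times> (nat \<Rightarrow> nat)"

definition cdiff :: "nat \<Rightarrow> sample_pair \<Rightarrow> nat \<Rightarrow> real" where
  "cdiff k h i = cnt k (fst h) i - cnt k (snd h) i"

definition ctot :: "nat \<Rightarrow> sample_pair \<Rightarrow> nat \<Rightarrow> real" where
  "ctot k h i = cnt k (fst h) i + cnt k (snd h) i"

text \<open>The summand 1 keeps the divisor in \<open>stat\<close> away from zero. The other two
  summands read different batches and are therefore independent.\<close>

definition wt :: "nat \<Rightarrow> sample_pair \<times> sample_pair \<Rightarrow> nat \<Rightarrow> real" where
  "wt k g i = 1 + \<bar>cdiff k (fst g) i\<bar> + sqrt (ctot k (snd g) i)"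

definition stat :: "nat \<Rightarrow> nat \<Rightarrow> sample_pair \<times> sample_pair \<Rightarrow> sample_pair \<times> sample_pair \<Rightarrow> real" where
  "stat n k g h = (\<Sum>i\<in>{1..n}. cdiff k (fst h) i * cdiff k (snd h) i / wt k g i)"

lemma ctot_nonneg: "0 \<le> ctot k h i"
  by (simp add: ctot_def cnt_def sum_nonneg)

lemma wt_ge_1: "1 \<le> wt k g i"
  by (simp add: wt_def ctot_nonneg)

lemma wt_pos: "0 < wt k g i"
  using wt_ge_1[of k g i] by linarith

text \<open>All cross terms of the expanded square are nonnegative. The first bound controls the
  reciprocal weight through \<open>snd g\<close> alone, the second through \<open>fst g\<close>
  alone.\<close>

lemma wt_square_ge:
  "1 + ctot k (snd g) i \<le> (wt k g i)\<^sup>2" "(cdiff k (fst g) i)\<^sup>2 \<le> (wt k g i)\<^sup>2"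
proof -
  let ?a = "\<bar>cdiff k (fst g) i\<bar>" and ?b = "sqrt (ctot k (snd g) i)"
  have "(wt k g i)\<^sup>2 = 1 + ?a\<^sup>2 + ?b\<^sup>2 + 2 * ?a + 2 * ?b + 2 * (?a * ?b)"
    unfolding wt_def by algebra
  moreover have "?b\<^sup>2 = ctot k (snd g) i" "0 \<le> ?a" "0 \<le> ?b" "0 \<le> ?a * ?b" "?a\<^sup>2 = (cdiff k (fst g) i)\<^sup>2"
    by (auto simp: ctot_nonneg)
  ultimately show "1 + ctot k (snd g) i \<le> (wt k g i)\<^sup>2" "(cdiff k (fst g) i)\<^sup>2 \<le> (wt k g i)\<^sup>2"
    using ctot_nonneg[of k "snd g" i] zero_le_power2[of "cdiff k (fst g) i"] by linarith+
qed

lemma sum_abs_le_sqrt: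
  fixes x :: "'a \<Rightarrow> real"
  assumes "(\<Sum>i\<in>A. (x i)\<^sup>2) \<le> b"
  shows "(\<Sum>i\<in>A. \<bar>x i\<bar>) \<le> sqrt (real (card A) * b)"
proof (rule real_le_rsqrt)
  have "(\<Sum>i\<in>A. 1 * \<bar>x i\<bar>)\<^sup>2 \<le> (\<Sum>i\<in>A. 1\<^sup>2) * (\<Sum>i\<in>A. \<bar>x i\<bar>\<^sup>2)"
    by (rule Cauchy_Schwarz_ineq_sum)
  also have "\<dots> \<le> real (card A) * b" using assms by (simp add: mult_left_mono)
  finally show "(\<Sum>i\<in>A. \<bar>x i\<bar>)\<^sup>2 \<le> real (card A) * b" by simp
qed

section \<open>Second moments of the counts and of the reciprocal weights\<close>

locale two_sample =
  fixes n k :: nat and p q :: "nat pmf"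
  assumes p: "dist_on n p" and q: "dist_on n q"
begin

definition P :: "sample_pair pmf" where "P = pair_pmf (samples k p) (samples k q)"
definition d :: "nat \<Rightarrow> real" where "d i = real k * (pmf p i - pmf q i)"
definition s :: "nat \<Rightarrow> real" where "s i = real k * (pmf p i + pmf q i)"

lemma s_nonneg: "0 \<le> s i"
  by (simp add: s_def)

lemma sum_s: "(\<Sum>i\<in>{1..n}. s i) = 2 * real k"
proof -
  have "(\<Sum>i\<in>{1..n}. pmf p i) = 1" "(\<Sum>i\<in>{1..n}. pmf q i) = 1"
    using p q by (auto simp: dist_on_def intro!: sum_pmf_eq_1)
  then show ?thesis
    by (simp add: s_def sum_distrib_left[symmetric] sum.distrib)
qed

lemma sum_abs_d: "(\<Sum>i\<in>{1..n}. \<bar>d i\<bar>) = real k * l1_dist n p q"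
  by (simp add: d_def l1_dist_def abs_mult sum_distrib_left)

lemma finite_P: "finite (set_pmf P)" and finite_PP: "finite (set_pmf (pair_pmf P P))"
  using finite_set_pmf_samples[OF finite_set_pmf_dist_on[OF p], of k]
    finite_set_pmf_samples[OF finite_set_pmf_dist_on[OF q], of k]
  by (auto simp: P_def)

lemmas integrable_P = integrable_measure_pmf_finite[OF finite_P]

text \<open>The sign \<sigma> treats totals and differences at once. The contributions of
  \<open>p\<close> and \<open>q\<close> are separated by (a + b)^2 \<le> 2 a^2 + 2 b^2, whose two
  sides differ by (a - b)^2, and each is bounded by \<open>variance_linear_form_cnt\<close>.\<close>

lemma variance_signed_counts:
  fixes \<sigma> :: real
  assumes "\<sigma>\<^sup>2 = 1"
  shows "measure_pmf.expectation P (\<lambda>h. (\<Sum>i\<in>{1..n}. g i *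
      ((cnt k (fst h) i - real k * pmf p i) + \<sigma> * (cnt k (snd h) i - real k * pmf q i)))\<^sup>2)
    \<le> 2 * (\<Sum>i\<in>{1..n}. (g i)\<^sup>2 * s i)"
proof -
  define A where "A = (\<lambda>xs. \<Sum>i\<in>{1..n}. g i * (cnt k xs i - real k * pmf p i))"
  define B where "B = (\<lambda>ys. \<Sum>i\<in>{1..n}. g i * (cnt k ys i - real k * pmf q i))"
  have "(\<Sum>i\<in>{1..n}. g i * ((cnt k (fst h) i - real k * pmf p i)
      + \<sigma> * (cnt k (snd h) i - real k * pmf q i))) = A (fst h) + \<sigma> * B (snd h)" for h
    unfolding A_def B_def sum_distrib_left sum.distrib[symmetric]
    by (intro sum.cong refl) (simp add: algebra_simps)
  moreover have "(A (fst h) + \<sigma> * B (snd h))\<^sup>2 \<le> 2 * (A (fst h))\<^sup>2 + 2 * (B (snd h))\<^sup>2" for h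
  proof -
    have "2 * (A (fst h))\<^sup>2 + 2 * (\<sigma>\<^sup>2 * (B (snd h))\<^sup>2) - (A (fst h) + \<sigma> * B (snd h))\<^sup>2 =
        (A (fst h) - \<sigma> * B (snd h))\<^sup>2" by algebra
    then show ?thesis
      unfolding assms using zero_le_power2[of "A (fst h) - \<sigma> * B (snd h)"] by linarith
  qed
  ultimately have "measure_pmf.expectation P (\<lambda>h. (\<Sum>i\<in>{1..n}. g i *
      ((cnt k (fst h) i - real k * pmf p i) + \<sigma> * (cnt k (snd h) i - real k * pmf q i)))\<^sup>2) \<le>
    measure_pmf.expectation P (\<lambda>h. 2 * (A (fst h))\<^sup>2 + 2 * (B (snd h))\<^sup>2)"
    by (intro expectation_mono_pmf finite_P) simp
  also have "\<dots> = 2 * measure_pmf.expectation P (\<lambda>h. (A (fst h))\<^sup>2)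
      + 2 * measure_pmf.expectation P (\<lambda>h. (B (snd h))\<^sup>2)"
    by (simp add: integrable_P)
  also have "\<dots> = 2 * measure_pmf.expectation (samples k p) (\<lambda>xs. (A xs)\<^sup>2)
      + 2 * measure_pmf.expectation (samples k q) (\<lambda>ys. (B ys)\<^sup>2)"
    unfolding P_def
    using expectation_pair_pmf_fst[of "samples k p" "samples k q" "\<lambda>xs. (A xs)\<^sup>2"]
      expectation_pair_pmf_snd[of "samples k p" "samples k q" "\<lambda>ys. (B ys)\<^sup>2"] by simp
  also have "\<dots> \<le> 2 * (real k * (\<Sum>i\<in>{1..n}. (g i)\<^sup>2 * pmf p i))
      + 2 * (real k * (\<Sum>i\<in>{1..n}. (g i)\<^sup>2 * pmf q i))"
    unfolding A_def B_def
    by (intro add_mono mult_left_mono variance_linear_form_cnt p q) auto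
  also have "\<dots> = 2 * (\<Sum>i\<in>{1..n}. (g i)\<^sup>2 * s i)"
    by (simp add: s_def sum_distrib_left sum.distrib[symmetric] algebra_simps)
  finally show ?thesis .
qed

lemma variance_cdiff_form:
  "measure_pmf.expectation P (\<lambda>h. (\<Sum>i\<in>{1..n}. g i * (cdiff k h i - d i))\<^sup>2)
    \<le> 2 * (\<Sum>i\<in>{1..n}. (g i)\<^sup>2 * s i)"
  using variance_signed_counts[of "-1" g] by (simp add: cdiff_def d_def algebra_simps)

lemma variance_ctot_form:
  "measure_pmf.expectation P (\<lambda>h. (\<Sum>i\<in>{1..n}. g i * (ctot k h i - s i))\<^sup>2)
    \<le> 2 * (\<Sum>i\<in>{1..n}. (g i)\<^sup>2 * s i)"
  using variance_signed_counts[of 1 g] by (simp add: ctot_def s_def algebra_simps)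

text \<open>Indicator weights specialise the bounds for linear forms to a single index.\<close>

lemma sum_indicator_1n:
  assumes "i \<in> {1..n}"
  shows "(\<Sum>j\<in>{1..n}. (if j = i then 1 else 0) * f j) = f i"
    and "(\<Sum>j\<in>{1..n}. (if j = i then 1 else 0)\<^sup>2 * f j) = (f i :: real)"
proof -
  show *: "(\<Sum>j\<in>{1..n}. (if j = i then 1 else 0) * f j) = f i"
    using assms by (simp add: if_distrib[of "\<lambda>c. c * _"] cong: if_cong)
  have "(if j = i then 1 else 0 :: real)\<^sup>2 = (if j = i then 1 else 0)" for j by simp
  then show "(\<Sum>j\<in>{1..n}. (if j = i then 1 else 0)\<^sup>2 * f j) = f i" using * by simp
qed

lemma variance_cdiff:
  assumes "i \<in> {1..n}"
  shows "measure_pmf.expectation P (\<lambda>h. (cdiff k h i - d i)\<^sup>2) \<le> 2 * s i"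
  using variance_cdiff_form[of "\<lambda>j. if j = i then 1 else 0"]
  unfolding sum_indicator_1n[OF assms] .

lemma variance_ctot:
  assumes "i \<in> {1..n}"
  shows "measure_pmf.expectation P (\<lambda>h. (ctot k h i - s i)\<^sup>2) \<le> 2 * s i"
  using variance_ctot_form[of "\<lambda>j. if j = i then 1 else 0"]
  unfolding sum_indicator_1n[OF assms] .

text \<open>If \<open>ctot\<close> is at least half of \<open>s i\<close>, the quotient is at most
  2. Otherwise \<open>ctot\<close> deviates from \<open>s i\<close> by more than
  \<open>s i / 2\<close>, and the quotient is at most \<open>4 / s i\<close> times the squared
  deviation. The latter has expectation at most 8 by \<open>variance_ctot\<close>.\<close>

lemma expectation_inverse_ctot:
  assumes "i \<in> {1..n}"
  shows "s i * measure_pmf.expectation P (\<lambda>h. 1 / (1 + ctot k h i)) \<le> 10"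
proof (cases "s i = 0")
  case False
  then have pos: "0 < s i" using s_nonneg[of i] by simp
  have "s i * (1 / (1 + ctot k h i)) \<le> 2 + 4 / s i * (ctot k h i - s i)\<^sup>2" for h
  proof (cases "s i / 2 \<le> ctot k h i")
    case True
    then have "s i * (1 / (1 + ctot k h i)) \<le> 2"
      using ctot_nonneg[of k h i] by (simp add: field_simps)
    moreover have "0 \<le> 4 / s i * (ctot k h i - s i)\<^sup>2" using pos by simp
    ultimately show ?thesis by linarith
  next
    case False
    have "s i * (1 / (1 + ctot k h i)) \<le> s i * 1"
      using ctot_nonneg[of k h i] pos by (intro mult_left_mono) auto
    also have "\<dots> = 4 / s i * (s i / 2)\<^sup>2" using pos by (simp add: field_simps power2_eq_square)
    also have "\<dots> \<le> 4 / s i * (s i - ctot k h i)\<^sup>2"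
      using False pos by (intro mult_left_mono power_mono) auto
    finally show ?thesis by (simp add: power2_commute)
  qed
  then have "measure_pmf.expectation P (\<lambda>h. s i * (1 / (1 + ctot k h i))) \<le>
      measure_pmf.expectation P (\<lambda>h. 2 + 4 / s i * (ctot k h i - s i)\<^sup>2)"
    by (intro expectation_mono_pmf finite_P)
  also have "\<dots> = 2 + 4 / s i * measure_pmf.expectation P (\<lambda>h. (ctot k h i - s i)\<^sup>2)"
    unfolding expectation_add_pmf[OF finite_P] by simp
  also have "\<dots> \<le> 2 + 4 / s i * (2 * s i)"
    using pos by (intro add_left_mono mult_left_mono variance_ctot assms) auto
  also have "\<dots> = 10" using pos by simp
  finally show ?thesis by (simp only: integral_mult_right_zero)
qed simp

lemma expectation_inverse_wt_square:
  assumes "i \<in> {1..n}"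
  shows "s i * measure_pmf.expectation (pair_pmf P P) (\<lambda>g. 1 / (wt k g i)\<^sup>2) \<le> 10"
proof -
  have "measure_pmf.expectation (pair_pmf P P) (\<lambda>g. 1 / (wt k g i)\<^sup>2)
      \<le> measure_pmf.expectation (pair_pmf P P) (\<lambda>g. 1 / (1 + ctot k (snd g) i))"
    by (intro expectation_mono_pmf finite_PP divide_left_mono wt_square_ge mult_pos_pos
        zero_less_power wt_pos add_pos_nonneg ctot_nonneg) auto
  also have "\<dots> = measure_pmf.expectation P (\<lambda>h. 1 / (1 + ctot k h i))"
    by (rule expectation_pair_pmf_snd)
  finally have "s i * measure_pmf.expectation (pair_pmf P P) (\<lambda>g. 1 / (wt k g i)\<^sup>2) \<le>
      s i * measure_pmf.expectation P (\<lambda>h. 1 / (1 + ctot k h i))"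
    by (intro mult_left_mono s_nonneg)
  with expectation_inverse_ctot[OF assms] show ?thesis by linarith
qed

text \<open>The two batches entering the weight are independent, so the event that \<^term>\<open>cdiff\<close>
  is far below \<open>|d\<^sub>i|\<close>, of probability \<open>O(s\<^sub>i / d\<^sub>i\<^sup>2)\<close>, is compensated by the factor
  \<open>1 / s\<^sub>i\<close> gained from the other batch.\<close>

lemma expectation_d_over_wt_square:
  assumes i: "i \<in> {1..n}"
  shows "measure_pmf.expectation (pair_pmf P P) (\<lambda>g. (d i)\<^sup>2 / (wt k g i)\<^sup>2) \<le> 84"
proof -
  define \<xi> where "\<xi> = (\<lambda>h. (cdiff k h i - d i)\<^sup>2)"
  define I where "I = (\<lambda>h. 1 / (1 + ctot k h i))"
  have I0: "0 \<le> I h" for h using ctot_nonneg[of k h i] by (simp add: I_def)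
  have "(d i)\<^sup>2 / (wt k g i)\<^sup>2 \<le> 4 + 4 * (\<xi> (fst g) * I (snd g))" for g
  proof (cases "\<bar>d i\<bar> / 2 \<le> \<bar>cdiff k (fst g) i\<bar>")
    case True
    have "(d i)\<^sup>2 = 4 * (\<bar>d i\<bar> / 2)\<^sup>2" by (simp add: power2_eq_square)
    also have "\<dots> \<le> 4 * \<bar>cdiff k (fst g) i\<bar>\<^sup>2" using True by (intro mult_left_mono power_mono) auto
    also have "\<dots> \<le> 4 * (wt k g i)\<^sup>2" using wt_square_ge(2)[of k g i] by simp
    finally have "(d i)\<^sup>2 / (wt k g i)\<^sup>2 \<le> 4"
      using wt_ge_1[of k g i] by (simp add: divide_le_eq)
    moreover have "0 \<le> \<xi> (fst g) * I (snd g)" by (simp add: \<xi>_def I0)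
    ultimately show ?thesis by linarith
  next
    case False
    then have far: "\<bar>d i\<bar> / 2 \<le> \<bar>cdiff k (fst g) i - d i\<bar>" by linarith
    have "(d i)\<^sup>2 = 4 * (\<bar>d i\<bar> / 2)\<^sup>2" by (simp add: power2_eq_square)
    also have "\<dots> \<le> 4 * \<bar>cdiff k (fst g) i - d i\<bar>\<^sup>2"
      using far by (intro mult_left_mono power_mono) auto
    finally have "(d i)\<^sup>2 \<le> 4 * \<xi> (fst g)" by (simp add: \<xi>_def)
    moreover have "1 / (wt k g i)\<^sup>2 \<le> I (snd g)"
      unfolding I_def using wt_square_ge(1)[of k g i] ctot_nonneg[of k "snd g" i]
      by (intro divide_left_mono) (auto intro!: mult_pos_pos)
    ultimately have "(d i)\<^sup>2 * (1 / (wt k g i)\<^sup>2) \<le> (4 * \<xi> (fst g)) * I (snd g)"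
      by (intro mult_mono) (auto simp: \<xi>_def)
    then show ?thesis by simp
  qed
  then have "measure_pmf.expectation (pair_pmf P P) (\<lambda>g. (d i)\<^sup>2 / (wt k g i)\<^sup>2) \<le>
      measure_pmf.expectation (pair_pmf P P) (\<lambda>g. 4 + 4 * (\<xi> (fst g) * I (snd g)))"
    by (intro expectation_mono_pmf finite_PP)
  \<comment> \<open>The two factors read the independent batches \<open>fst g\<close> and
    \<open>snd g\<close>, so the expectation of the product factors. It is bounded by 20 below, and
    4 + 4 * 20 = 84.\<close>
  also have "\<dots> = 4 + 4 * (measure_pmf.expectation P \<xi> * measure_pmf.expectation P I)"
    unfolding expectation_add_pmf[OF finite_PP] expectation_pair_pmf[OF finite_P finite_P] by simp
  also have "measure_pmf.expectation P \<xi> * measure_pmf.expectation P I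
      \<le> (2 * s i) * measure_pmf.expectation P I"
    using variance_cdiff[OF i] by (intro mult_right_mono Bochner_Integration.integral_nonneg)
      (auto simp: \<xi>_def I0)
  also have "\<dots> \<le> 20" using expectation_inverse_ctot[OF i] by (simp add: I_def)
  finally show ?thesis by simp
qed

text \<open>From t \<le> 1/2 + t^2 / 2 and the previous bound, since 1/2 + 84/2 is at most
  43.\<close>

lemma expectation_d_over_wt:
  assumes "i \<in> {1..n}"
  shows "measure_pmf.expectation (pair_pmf P P) (\<lambda>g. \<bar>d i\<bar> / wt k g i) \<le> 43"
proof -
  have "\<bar>d i\<bar> / wt k g i \<le> 1/2 + 1/2 * ((d i)\<^sup>2 / (wt k g i)\<^sup>2)" for g
  proof -
    have "0 \<le> (1 - \<bar>d i\<bar> / wt k g i)\<^sup>2" by simp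
    then show ?thesis by (simp add: power2_diff power_divide)
  qed
  then have "measure_pmf.expectation (pair_pmf P P) (\<lambda>g. \<bar>d i\<bar> / wt k g i) \<le>
      measure_pmf.expectation (pair_pmf P P) (\<lambda>g. 1/2 + 1/2 * ((d i)\<^sup>2 / (wt k g i)\<^sup>2))"
    by (intro expectation_mono_pmf finite_PP)
  also have "\<dots> = 1/2 + 1/2 * measure_pmf.expectation (pair_pmf P P) (\<lambda>g. (d i)\<^sup>2 / (wt k g i)\<^sup>2)"
    unfolding expectation_add_pmf[OF finite_PP] integral_mult_right_zero by simp
  finally show ?thesis using expectation_d_over_wt_square[OF assms] by linarith
qed

section \<open>Conditional mean and variance of the statistic\<close>

lemma variance_bilinear_form:
  "measure_pmf.expectation (pair_pmf P P)
      (\<lambda>h. (\<Sum>i\<in>{1..n}. w i * (cdiff k (fst h) i * cdiff k (snd h) i - (d i)\<^sup>2))\<^sup>2)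
    \<le> 12 * (\<Sum>i\<in>{1..n}. (w i)\<^sup>2 * (d i)\<^sup>2 * s i) + 12 * (\<Sum>i\<in>{1..n}. (w i)\<^sup>2 * (s i)\<^sup>2)"
proof -
  define L where "L = (\<lambda>h. \<Sum>i\<in>{1..n}. (w i * d i) * (cdiff k h i - d i))"
  define Q where "Q = (\<lambda>h h'. \<Sum>i\<in>{1..n}. (w i * (cdiff k h i - d i)) * (cdiff k h' i - d i))"
  define SL where "SL = (\<Sum>i\<in>{1..n}. (w i)\<^sup>2 * (d i)\<^sup>2 * s i)"
  \<comment> \<open>With X and Y the two estimates of d, X Y - d^2 = d (X - d) + d (Y - d) + (X - d)
    (Y - d): a linear form in each batch and one bilinear form in the centered estimates.\<close>
  have split: "(\<Sum>i\<in>{1..n}. w i * (cdiff k (fst h) i * cdiff k (snd h) i - (d i)\<^sup>2)) =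
      L (fst h) + L (snd h) + Q (fst h) (snd h)" for h
    unfolding L_def Q_def sum.distrib[symmetric]
    by (intro sum.cong refl) (simp add: algebra_simps power2_eq_square)
  have "(a + b + c)\<^sup>2 \<le> 3 * a\<^sup>2 + 3 * b\<^sup>2 + 3 * c\<^sup>2" for a b c :: real
  proof -
    have "3 * a\<^sup>2 + 3 * b\<^sup>2 + 3 * c\<^sup>2 - (a + b + c)\<^sup>2 = (a - b)\<^sup>2 + (b - c)\<^sup>2 + (a - c)\<^sup>2" by algebra
    then show ?thesis
      using zero_le_power2[of "a - b"] zero_le_power2[of "b - c"] zero_le_power2[of "a - c"] by linarith
  qed
  then have "measure_pmf.expectation (pair_pmf P P)
      (\<lambda>h. (\<Sum>i\<in>{1..n}. w i * (cdiff k (fst h) i * cdiff k (snd h) i - (d i)\<^sup>2))\<^sup>2) \<le>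
    measure_pmf.expectation (pair_pmf P P)
      (\<lambda>h. 3 * (L (fst h))\<^sup>2 + 3 * (L (snd h))\<^sup>2 + 3 * (Q (fst h) (snd h))\<^sup>2)"
    unfolding split by (intro expectation_mono_pmf finite_PP)
  also have "\<dots> = 3 * measure_pmf.expectation (pair_pmf P P) (\<lambda>h. (L (fst h))\<^sup>2)
      + 3 * measure_pmf.expectation (pair_pmf P P) (\<lambda>h. (L (snd h))\<^sup>2)
      + 3 * measure_pmf.expectation (pair_pmf P P) (\<lambda>h. (Q (fst h) (snd h))\<^sup>2)"
    unfolding expectation_add_pmf[OF finite_PP] by simp
  also have "measure_pmf.expectation (pair_pmf P P) (\<lambda>h. (L (fst h))\<^sup>2) =
      measure_pmf.expectation P (\<lambda>h. (L h)\<^sup>2)" by (rule expectation_pair_pmf_fst)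
  also have "measure_pmf.expectation (pair_pmf P P) (\<lambda>h. (L (snd h))\<^sup>2) =
      measure_pmf.expectation P (\<lambda>h. (L h)\<^sup>2)" by (rule expectation_pair_pmf_snd)
  also have "measure_pmf.expectation (pair_pmf P P) (\<lambda>h. (Q (fst h) (snd h))\<^sup>2) =
      measure_pmf.expectation P (\<lambda>h. measure_pmf.expectation P (\<lambda>h'. (Q h h')\<^sup>2))"
    by (simp add: expectation_pair_pmf[OF finite_P finite_P])
  finally have bound: "measure_pmf.expectation (pair_pmf P P)
      (\<lambda>h. (\<Sum>i\<in>{1..n}. w i * (cdiff k (fst h) i * cdiff k (snd h) i - (d i)\<^sup>2))\<^sup>2) \<le>
    6 * measure_pmf.expectation P (\<lambda>h. (L h)\<^sup>2) +
    3 * measure_pmf.expectation P (\<lambda>h. measure_pmf.expectation P (\<lambda>h'. (Q h h')\<^sup>2))"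
    by linarith
  have L: "measure_pmf.expectation P (\<lambda>h. (L h)\<^sup>2) \<le> 2 * SL"
    using variance_cdiff_form[of "\<lambda>i. w i * d i"]
    by (simp add: L_def SL_def power_mult_distrib)
  \<comment> \<open>For a fixed first batch, \<open>Q\<close> is a linear form in the second one, so
    the variance bound for linear forms applies. The squares of the first batch that remain are then
    averaged by \<open>variance_cdiff\<close>.\<close>
  have "measure_pmf.expectation P (\<lambda>h. measure_pmf.expectation P (\<lambda>h'. (Q h h')\<^sup>2)) \<le>
      measure_pmf.expectation P (\<lambda>h. 2 * (\<Sum>i\<in>{1..n}. ((w i)\<^sup>2 * s i) * (cdiff k h i - d i)\<^sup>2))"
  proof (intro expectation_mono_pmf finite_P)
    fix h
    show "measure_pmf.expectation P (\<lambda>h'. (Q h h')\<^sup>2) \<le>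
        2 * (\<Sum>i\<in>{1..n}. ((w i)\<^sup>2 * s i) * (cdiff k h i - d i)\<^sup>2)"
      using variance_cdiff_form[of "\<lambda>i. w i * (cdiff k h i - d i)"]
      by (simp add: Q_def power_mult_distrib mult_ac)
  qed
  also have "\<dots> = 2 * (\<Sum>i\<in>{1..n}. ((w i)\<^sup>2 * s i) * measure_pmf.expectation P (\<lambda>h. (cdiff k h i - d i)\<^sup>2))"
    by (simp add: integrable_P)
  also have "\<dots> \<le> 2 * (\<Sum>i\<in>{1..n}. ((w i)\<^sup>2 * s i) * (2 * s i))"
    by (intro mult_left_mono sum_mono variance_cdiff) (auto simp: s_nonneg)
  also have "\<dots> = 4 * (\<Sum>i\<in>{1..n}. (w i)\<^sup>2 * (s i)\<^sup>2)"
    by (simp add: sum_distrib_left power2_eq_square mult_ac)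
  finally show ?thesis using bound L unfolding SL_def by linarith
qed

text \<open>The conditional mean of \<open>stat n k g h\<close> given the weight batches
  \<open>g\<close>: the two factors taken from \<open>h\<close> are independent and unbiased
  estimates of \<open>d i\<close>.\<close>

definition cmean :: "sample_pair \<times> sample_pair \<Rightarrow> real" where
  "cmean g = (\<Sum>i\<in>{1..n}. (d i)\<^sup>2 / wt k g i)"

lemma cmean_nonneg: "0 \<le> cmean g"
  unfolding cmean_def by (intro sum_nonneg divide_nonneg_pos wt_pos) simp

text \<open>One factor \<open>\<bar>d i\<bar>\<close> is pulled out of the square; the other,
  divided by the weight, has expectation at most 43.\<close>

lemma expectation_cmean:
  "measure_pmf.expectation (pair_pmf P P) cmean \<le> 43 * (real k * l1_dist n p q)"
proof -
  have "measure_pmf.expectation (pair_pmf P P) cmean =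
      (\<Sum>i\<in>{1..n}. \<bar>d i\<bar> * measure_pmf.expectation (pair_pmf P P) (\<lambda>g. \<bar>d i\<bar> / wt k g i))"
    unfolding cmean_def expectation_sum_pmf[OF finite_PP]
  proof (intro sum.cong refl)
    fix i
    have "(d i)\<^sup>2 / wt k g i = \<bar>d i\<bar> * (\<bar>d i\<bar> / wt k g i)" for g
      by (simp add: power2_eq_square)
    then show "measure_pmf.expectation (pair_pmf P P) (\<lambda>g. (d i)\<^sup>2 / wt k g i) =
        \<bar>d i\<bar> * measure_pmf.expectation (pair_pmf P P) (\<lambda>g. \<bar>d i\<bar> / wt k g i)"
      by (simp only: integral_mult_right_zero)
  qed
  also have "\<dots> \<le> (\<Sum>i\<in>{1..n}. \<bar>d i\<bar> * 43)"
    by (intro sum_mono mult_left_mono expectation_d_over_wt) auto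
  also have "\<dots> = 43 * (real k * l1_dist n p q)"
    by (simp add: sum_abs_d[symmetric] sum_distrib_left mult.commute)
  finally show ?thesis .
qed

text \<open>For fixed \<open>g\<close> this is the bilinear variance with weights
  \<open>1 / wt k g i\<close>. Averaging over \<open>g\<close> bounds each index by a multiple of
  \<open>s i\<close>, and \<open>sum_s\<close> gives 12 * (84 + 10) * 2 = 2256.\<close>

lemma expectation_stat_deviation:
  "measure_pmf.expectation (pair_pmf (pair_pmf P P) (pair_pmf P P))
    (\<lambda>(g, h). (stat n k g h - cmean g)\<^sup>2) \<le> 2256 * real k"
proof -
  let ?E = "measure_pmf.expectation (pair_pmf P P)"
  have "measure_pmf.expectation (pair_pmf (pair_pmf P P) (pair_pmf P P))
      (\<lambda>(g, h). (stat n k g h - cmean g)\<^sup>2) = ?E (\<lambda>g. ?E (\<lambda>h. (stat n k g h - cmean g)\<^sup>2))"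
    by (simp add: expectation_pair_pmf[OF finite_PP finite_PP])
  also have "\<dots> \<le> ?E (\<lambda>g. 12 * (\<Sum>i\<in>{1..n}. s i * ((d i)\<^sup>2 / (wt k g i)\<^sup>2))
      + 12 * (\<Sum>i\<in>{1..n}. (s i)\<^sup>2 * (1 / (wt k g i)\<^sup>2)))"
  proof (intro expectation_mono_pmf finite_PP)
    fix g
    have "stat n k g h - cmean g =
        (\<Sum>i\<in>{1..n}. 1 / wt k g i * (cdiff k (fst h) i * cdiff k (snd h) i - (d i)\<^sup>2))" for h
      unfolding stat_def cmean_def sum_subtractf[symmetric]
      by (intro sum.cong refl) (simp add: diff_divide_distrib)
    then show "?E (\<lambda>h. (stat n k g h - cmean g)\<^sup>2) \<le>
        12 * (\<Sum>i\<in>{1..n}. s i * ((d i)\<^sup>2 / (wt k g i)\<^sup>2))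
        + 12 * (\<Sum>i\<in>{1..n}. (s i)\<^sup>2 * (1 / (wt k g i)\<^sup>2))"
      using variance_bilinear_form[of "\<lambda>i. 1 / wt k g i"]
      by (simp add: power_divide mult.commute)
  qed
  also have "\<dots> = 12 * (\<Sum>i\<in>{1..n}. s i * ?E (\<lambda>g. (d i)\<^sup>2 / (wt k g i)\<^sup>2))
      + 12 * (\<Sum>i\<in>{1..n}. s i * (s i * ?E (\<lambda>g. 1 / (wt k g i)\<^sup>2)))"
    unfolding expectation_add_pmf[OF finite_PP] integral_mult_right_zero expectation_sum_pmf[OF finite_PP]
    by (simp add: power2_eq_square mult.assoc)
  also have "\<dots> \<le> 12 * (\<Sum>i\<in>{1..n}. s i * 84) + 12 * (\<Sum>i\<in>{1..n}. s i * 10)"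
    by (intro add_mono mult_left_mono sum_mono expectation_d_over_wt_square
        expectation_inverse_wt_square) (auto simp: s_nonneg)
  also have "\<dots> = 2256 * real k"
    by (simp only: sum_distrib_right[symmetric] sum_s)
  finally show ?thesis .
qed

section \<open>Separating the close and the far case\<close>

lemma sum_ctot:
  assumes "h \<in> set_pmf P"
  shows "(\<Sum>i\<in>{1..n}. ctot k h i) = 2 * real k"
  using assms sum_cnt_samples[OF p, of "fst h" k "\<lambda>_. 1"] sum_cnt_samples[OF q, of "snd h" k "\<lambda>_. 1"]
  by (auto simp: P_def ctot_def sum.distrib)

text \<open>Splitting \<open>\<bar>d i\<bar>\<close> as its quotient by
  \<open>sqrt (wt k g i)\<close> times that root, Cauchy-Schwarz bounds the squared sum of the
  \<open>\<bar>d i\<bar>\<close> by \<open>cmean g\<close> times the total weight. The hypothesis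
  \<open>dev\<close> and \<open>sum_ctot\<close> bound the total weight, again by
  Cauchy-Schwarz.\<close>

lemma cmean_lower_bound:
  assumes dev: "(\<Sum>i\<in>{1..n}. (cdiff k (fst g) i - d i)\<^sup>2) \<le> 40 * real k"
    and g: "snd g \<in> set_pmf P" and n: "1 \<le> n"
    and far: "e \<le> l1_dist n p q" and e: "0 \<le> e"
  shows "(real k * e)\<^sup>2 / (real k * e + 9 * sqrt (real k * real n) + real n) \<le> cmean g"
proof -
  define D where "D = real k * l1_dist n p q"
  define D0 where "D0 = real k * e"
  \<comment> \<open>Here 9 = 7 + 2, where 7 bounds the root of 40 from \<open>dev\<close> and 2
    bounds the root of 2 from \<open>sum_ctot\<close>.\<close>
  define c where "c = 9 * sqrt (real k * real n) + real n"
  have D0: "0 \<le> D0" "D0 \<le> D" using far e by (auto simp: D_def D0_def mult_left_mono)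
  have c: "0 < c" using n by (simp add: c_def add_nonneg_pos)
  note wpos = wt_pos[of k g]
  have "(\<Sum>i\<in>{1..n}. \<bar>cdiff k (fst g) i - d i\<bar>) \<le> sqrt (real n * (40 * real k))"
    using sum_abs_le_sqrt[OF dev] by simp
  also have "\<dots> \<le> 7 * sqrt (real k * real n)"
    by (rule real_le_lsqrt) (auto simp: power_mult_distrib)
  finally have 1: "(\<Sum>i\<in>{1..n}. \<bar>cdiff k (fst g) i - d i\<bar>) \<le> 7 * sqrt (real k * real n)" .
  have "(\<Sum>i\<in>{1..n}. (sqrt (ctot k (snd g) i))\<^sup>2) \<le> 2 * real k"
    using sum_ctot[OF g] by (simp add: ctot_nonneg)
  from sum_abs_le_sqrt[OF this]
  have "(\<Sum>i\<in>{1..n}. sqrt (ctot k (snd g) i)) \<le> sqrt (real n * (2 * real k))"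
    by (simp add: ctot_nonneg)
  also have "\<dots> \<le> 2 * sqrt (real k * real n)"
    by (rule real_le_lsqrt) (auto simp: power_mult_distrib)
  finally have 2: "(\<Sum>i\<in>{1..n}. sqrt (ctot k (snd g) i)) \<le> 2 * sqrt (real k * real n)" .
  have "(\<Sum>i\<in>{1..n}. wt k g i) \<le>
      (\<Sum>i\<in>{1..n}. 1 + (\<bar>d i\<bar> + \<bar>cdiff k (fst g) i - d i\<bar>) + sqrt (ctot k (snd g) i))"
    unfolding wt_def by (intro sum_mono add_mono order_refl) linarith
  also have "\<dots> = real n + (D + (\<Sum>i\<in>{1..n}. \<bar>cdiff k (fst g) i - d i\<bar>)) + (\<Sum>i\<in>{1..n}. sqrt (ctot k (snd g) i))"
    unfolding D_def sum_abs_d[symmetric] sum.distrib by simp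
  also have "\<dots> \<le> D + c" using 1 2 by (simp add: c_def)
  finally have W: "(\<Sum>i\<in>{1..n}. wt k g i) \<le> D + c" .
  have "D\<^sup>2 = (\<Sum>i\<in>{1..n}. (\<bar>d i\<bar> / sqrt (wt k g i)) * sqrt (wt k g i))\<^sup>2"
    unfolding D_def sum_abs_d[symmetric] using wpos
    by (intro arg_cong[where f = "\<lambda>x. x\<^sup>2"] sum.cong refl) (simp add: less_imp_neq[symmetric])
  also have "\<dots> \<le> (\<Sum>i\<in>{1..n}. (\<bar>d i\<bar> / sqrt (wt k g i))\<^sup>2) * (\<Sum>i\<in>{1..n}. (sqrt (wt k g i))\<^sup>2)"
    by (rule Cauchy_Schwarz_ineq_sum)
  also have "\<dots> = cmean g * (\<Sum>i\<in>{1..n}. wt k g i)"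
    unfolding cmean_def using wpos by (simp add: power_divide less_imp_le)
  also have "\<dots> \<le> cmean g * (D + c)" by (intro mult_left_mono W cmean_nonneg)
  finally have "D\<^sup>2 / (D + c) \<le> cmean g" using D0 c by (simp add: divide_le_eq)
  \<comment> \<open>The map x^2 / (x + c) is increasing for nonnegative x, so the true scaled
    distance may be replaced by its lower bound.\<close>
  moreover have "D0\<^sup>2 / (D0 + c) \<le> D\<^sup>2 / (D + c)"
  proof -
    have "0 \<le> D * D0 * (D - D0) + c * ((D - D0) * (D + D0))" using D0 c by (intro add_nonneg_nonneg mult_nonneg_nonneg) auto
    also have "\<dots> = D\<^sup>2 * (D0 + c) - D0\<^sup>2 * (D + c)" by algebra
    finally show ?thesis using D0 c by (simp add: divide_le_eq le_divide_eq field_simps)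
  qed
  ultimately show ?thesis by (simp add: D0_def c_def add.assoc)
qed

text \<open>Exceeding \<tau> forces \<open>cmean\<close> to be at least \<tau>/2 or
  \<open>stat\<close> to deviate from it by at least \<tau>/2. Markov's inequality gives each event
  probability at most 1/10, with 860 = 20 * 43 and 90240 = 40 * 2256.\<close>

lemma stat_not_large_if_close:
  assumes \<tau>: "0 < \<tau>" "860 * (real k * l1_dist n p q) \<le> \<tau>" "90240 * real k \<le> \<tau>\<^sup>2"
  shows "measure_pmf.prob (pair_pmf (pair_pmf P P) (pair_pmf P P)) {(g, h). \<tau> < stat n k g h} \<le> 1/5"
proof -
  let ?J = "pair_pmf (pair_pmf P P) (pair_pmf P P)"
  let ?A = "{z. \<tau> / 2 \<le> cmean (fst z)}"
  let ?B = "{z. \<tau>\<^sup>2 / 4 \<le> (case z of (g, h) \<Rightarrow> (stat n k g h - cmean g)\<^sup>2)}"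
  have fin: "finite (set_pmf ?J)" using finite_PP by auto
  have "measure_pmf.expectation ?J (\<lambda>z. cmean (fst z)) \<le> 1/10 * (\<tau> / 2)"
    using expectation_cmean \<tau> by simp
  then have A: "measure_pmf.prob ?J ?A \<le> 1/10"
    using \<tau> by (intro markov_pmf fin) (auto simp: cmean_nonneg)
  have B: "measure_pmf.prob ?J ?B \<le> 1/10"
    using \<tau> expectation_stat_deviation by (intro markov_pmf fin) auto
  have "{(g, h). \<tau> < stat n k g h} \<subseteq> ?A \<union> ?B"
  proof
    fix z assume z: "z \<in> {(g, h). \<tau> < stat n k g h}"
    obtain g h where gh: "z = (g, h)" by (cases z)
    have "z \<in> ?B" if "z \<notin> ?A"
    proof -
      have "\<tau> / 2 \<le> stat n k g h - cmean g" using that z gh by simp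
      then have "(\<tau> / 2)\<^sup>2 \<le> (stat n k g h - cmean g)\<^sup>2" using \<tau> by (intro power_mono) auto
      then show ?thesis using gh by (simp add: power_divide)
    qed
    then show "z \<in> ?A \<union> ?B" by blast
  qed
  then have "measure_pmf.prob ?J {(g, h). \<tau> < stat n k g h} \<le> measure_pmf.prob ?J (?A \<union> ?B)"
    by (intro measure_pmf.finite_measure_mono) auto
  also have "\<dots> \<le> measure_pmf.prob ?J ?A + measure_pmf.prob ?J ?B"
    by (intro measure_Un_le) auto
  finally show ?thesis using A B by linarith
qed

text \<open>The threshold is half the lower bound on \<open>cmean\<close>, so failure needs either
  an atypical first weight batch or a statistic at least \<tau> below \<open>cmean\<close>. Each has
  probability at most 1/10; for the former, the expected squared deviation is at most 4 k, a tenth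
  of 40 k.\<close>

lemma stat_large_if_far:
  assumes \<tau>: "0 < \<tau>" "90240 * real k \<le> \<tau>\<^sup>2"
    and e: "0 \<le> e" "e \<le> l1_dist n p q" and nk: "1 \<le> n" "0 < k"
    and \<tau>_eq: "\<tau> = (real k * e)\<^sup>2 / (2 * (real k * e + 9 * sqrt (real k * real n) + real n))"
  shows "measure_pmf.prob (pair_pmf (pair_pmf P P) (pair_pmf P P)) {(g, h). \<not> \<tau> < stat n k g h} \<le> 1/5"
proof -
  let ?J = "pair_pmf (pair_pmf P P) (pair_pmf P P)"
  let ?dev = "\<lambda>h. \<Sum>i\<in>{1..n}. (cdiff k h i - d i)\<^sup>2"
  let ?A = "{z. 40 * real k \<le> ?dev (fst (fst z))}"
  let ?B = "{z. \<tau>\<^sup>2 \<le> (case z of (g, h) \<Rightarrow> (stat n k g h - cmean g)\<^sup>2)}"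
  have fin: "finite (set_pmf ?J)" using finite_PP by auto
  have "measure_pmf.expectation ?J (\<lambda>z. ?dev (fst (fst z))) =
      measure_pmf.expectation (pair_pmf P P) (\<lambda>g. ?dev (fst g))"
    by (rule expectation_pair_pmf_fst)
  also have "\<dots> = measure_pmf.expectation P ?dev" by (rule expectation_pair_pmf_fst)
  also have "\<dots> = (\<Sum>i\<in>{1..n}. measure_pmf.expectation P (\<lambda>h. (cdiff k h i - d i)\<^sup>2))"
    by (rule expectation_sum_pmf[OF finite_P])
  also have "\<dots> \<le> (\<Sum>i\<in>{1..n}. 2 * s i)" by (intro sum_mono variance_cdiff)
  also have "\<dots> = 1/10 * (40 * real k)" by (simp only: sum_distrib_left[symmetric] sum_s)
  finally have A: "measure_pmf.prob ?J ?A \<le> 1/10"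
    using nk by (intro markov_pmf fin) (auto intro: sum_nonneg)
  have B: "measure_pmf.prob ?J ?B \<le> 1/10"
    using \<tau> expectation_stat_deviation by (intro markov_pmf fin) auto
  \<comment> \<open>Restriction to the support is needed because \<open>cmean_lower_bound\<close>
    requires the second weight batch to be an actual sample.\<close>
  have "{(g, h). \<not> \<tau> < stat n k g h} \<inter> set_pmf ?J \<subseteq> ?A \<union> ?B"
  proof
    fix z assume z: "z \<in> {(g, h). \<not> \<tau> < stat n k g h} \<inter> set_pmf ?J"
    obtain g h where gh: "z = (g, h)" by (cases z)
    have "snd g \<in> set_pmf P" using z gh by auto
    have "z \<in> ?B" if "z \<notin> ?A"
    proof -
      have "?dev (fst g) \<le> 40 * real k" using that gh by simp
      from cmean_lower_bound[OF this \<open>snd g \<in> set_pmf P\<close> nk(1) e(2,1)]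
      have "2 * \<tau> \<le> cmean g" unfolding \<tau>_eq times_divide_eq_right by (subst mult_divide_mult_cancel_left) auto
      moreover have "stat n k g h \<le> \<tau>" using z gh by simp
      ultimately have "\<tau> \<le> cmean g - stat n k g h" by linarith
      then have "\<tau>\<^sup>2 \<le> (cmean g - stat n k g h)\<^sup>2" using \<tau> by (intro power_mono) auto
      then show ?thesis using gh by (simp add: power2_commute)
    qed
    then show "z \<in> ?A \<union> ?B" by blast
  qed
  then have "measure_pmf.prob ?J ({(g, h). \<not> \<tau> < stat n k g h} \<inter> set_pmf ?J)
      \<le> measure_pmf.prob ?J (?A \<union> ?B)"
    by (intro measure_pmf.finite_measure_mono) auto
  also have "\<dots> \<le> measure_pmf.prob ?J ?A + measure_pmf.prob ?J ?B"
    by (intro measure_Un_le) auto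
  finally show ?thesis using A B unfolding measure_Int_set_pmf by linarith
qed

end

section \<open>The tester and the law of its output\<close>

definition closeness_tester ::
  "nat \<Rightarrow> nat \<Rightarrow> real \<Rightarrow> (nat \<Rightarrow> nat) \<Rightarrow> (nat \<Rightarrow> nat) \<Rightarrow> bool pmf" where
  "closeness_tester n k \<tau> xs ys =
    (let (a, b) = halves (k + k) (xs, ys) in return_pmf (\<tau> < stat n k (halves k a) (halves k b)))"

text \<open>\<open>map_halves\<close> is used for the outer cut at \<open>k + k\<close> and again
  inside each half, which makes all four batches independent.\<close>

lemma run_closeness_tester:
  "run_tester (k + k + (k + k)) (closeness_tester n k \<tau>) p q =
    (let P = pair_pmf (samples k p) (samples k q)
     in map_pmf (\<lambda>(g, h). \<tau> < stat n k g h) (pair_pmf (pair_pmf P P) (pair_pmf P P)))"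
proof -
  let ?S = "\<lambda>m. pair_pmf (samples m p) (samples m q)"
  let ?F = "\<lambda>(g, h). \<tau> < stat n k g h"
  have "run_tester (k + k + (k + k)) (closeness_tester n k \<tau>) p q =
      map_pmf (\<lambda>z. ?F (halves k (fst z), halves k (snd z)))
        (map_pmf (halves (k + k)) (?S (k + k + (k + k))))"
    unfolding run_tester_def closeness_tester_def map_pmf_def pair_pmf_def
    by (simp add: bind_assoc_pmf bind_return_pmf case_prod_unfold Let_def)
  also have "\<dots> = map_pmf ?F (map_pmf (\<lambda>(a, b). (halves k a, halves k b))
      (pair_pmf (?S (k + k)) (?S (k + k))))"
    unfolding map_halves by (simp add: pmf.map_comp o_def case_prod_unfold)
  finally show ?thesis unfolding map_pair map_halves Let_def .
qed

section \<open>Arithmetic of the threshold and the sample size\<close>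

lemma threshold_bounds:
  fixes x N \<epsilon>\<^sub>1 \<epsilon>\<^sub>2 :: real
  defines "R \<equiv> x * \<epsilon>\<^sub>2 + 9 * sqrt (x * N) + N"
  assumes pos: "0 < x" "0 < N" "0 < \<epsilon>\<^sub>2" "0 \<le> \<epsilon>\<^sub>1"
    and 1: "50000 \<le> sqrt x * \<epsilon>\<^sub>2" and 2: "50000 * sqrt N \<le> x * \<epsilon>\<^sub>2\<^sup>2"
    and 3: "50000 * N \<le> x * sqrt x * \<epsilon>\<^sub>2\<^sup>2" and 4: "50000 * \<epsilon>\<^sub>1 \<le> \<epsilon>\<^sub>2"
    and 5: "50000 * (sqrt N * \<epsilon>\<^sub>1) \<le> sqrt x * \<epsilon>\<^sub>2\<^sup>2" and 6: "50000 * (N * \<epsilon>\<^sub>1) \<le> x * \<epsilon>\<^sub>2\<^sup>2"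
  shows "860 * (x * \<epsilon>\<^sub>1) \<le> (x * \<epsilon>\<^sub>2)\<^sup>2 / (2 * R)"
    and "90240 * x \<le> ((x * \<epsilon>\<^sub>2)\<^sup>2 / (2 * R))\<^sup>2"
proof -
  define r where "r = sqrt x"
  define t where "t = sqrt N"
  have r: "0 < r" "x = r * r" and t: "0 < t" "N = t * t"
    using pos by (auto simp: r_def t_def)
  have R: "R = x * \<epsilon>\<^sub>2 + 9 * (r * t) + N"
    by (simp add: R_def r_def t_def real_sqrt_mult)
  have Rpos: "0 < R" unfolding R using pos r t by (auto intro!: add_pos_pos mult_pos_pos)
  have "50000 * (r * (x * \<epsilon>\<^sub>2)) \<le> (x * \<epsilon>\<^sub>2)\<^sup>2"
    using mult_right_mono[OF 1, of "r * r * r * \<epsilon>\<^sub>2"] pos r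
    by (simp add: r_def[symmetric] power2_eq_square mult_ac)
  moreover have "50000 * (r * (r * t)) \<le> (x * \<epsilon>\<^sub>2)\<^sup>2"
    using mult_right_mono[OF 2, of "r * r"] pos r
    by (simp add: t_def[symmetric] power2_eq_square mult_ac)
  moreover have "50000 * (r * N) \<le> (x * \<epsilon>\<^sub>2)\<^sup>2"
    using mult_right_mono[OF 3, of "r"] pos r
    by (simp add: r_def[symmetric] power2_eq_square mult_ac)
  moreover have "r * R = r * (x * \<epsilon>\<^sub>2) + 9 * (r * (r * t)) + r * N"
    unfolding R by (simp add: algebra_simps)
  \<comment> \<open>The summands of \<open>R\<close> enter with factors 1, 9 and 1, and 602 * 11
    \<le> 50000. The factor 2 in the threshold leaves 301, whose square exceeds 90240.\<close>
  ultimately have "602 * (r * R) \<le> (x * \<epsilon>\<^sub>2)\<^sup>2"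
    using zero_le_power2[of "x * \<epsilon>\<^sub>2"] by linarith
  then have "301 * r \<le> (x * \<epsilon>\<^sub>2)\<^sup>2 / (2 * R)"
    using Rpos by (simp add: le_divide_eq mult_ac)
  then have "(301 * r)\<^sup>2 \<le> ((x * \<epsilon>\<^sub>2)\<^sup>2 / (2 * R))\<^sup>2"
    using r by (intro power_mono) auto
  moreover have "90240 * x \<le> (301 * r)\<^sup>2"
    using pos r by (simp add: power2_eq_square)
  ultimately show "90240 * x \<le> ((x * \<epsilon>\<^sub>2)\<^sup>2 / (2 * R))\<^sup>2" by linarith
  \<comment> \<open>The same comparison, summand by summand of \<open>R\<close>, now with the
    close-case mean in place of the standard deviation; here 1720 = 2 * 860 and 1720 * 11 \<le>
    50000.\<close>
  have "50000 * (x * \<epsilon>\<^sub>1 * (x * \<epsilon>\<^sub>2)) \<le> (x * \<epsilon>\<^sub>2)\<^sup>2"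
    using mult_right_mono[OF 4, of "x * x * \<epsilon>\<^sub>2"] pos
    by (simp add: power2_eq_square mult_ac)
  moreover have "50000 * (x * \<epsilon>\<^sub>1 * (r * t)) \<le> (x * \<epsilon>\<^sub>2)\<^sup>2"
    using mult_right_mono[OF 5, of "r * r * r"] pos r
    by (simp add: r_def[symmetric] t_def[symmetric] power2_eq_square mult_ac)
  moreover have "50000 * (x * \<epsilon>\<^sub>1 * N) \<le> (x * \<epsilon>\<^sub>2)\<^sup>2"
    using mult_right_mono[OF 6, of x] pos
    by (simp add: power2_eq_square mult_ac)
  moreover have "x * \<epsilon>\<^sub>1 * R = x * \<epsilon>\<^sub>1 * (x * \<epsilon>\<^sub>2) + 9 * (x * \<epsilon>\<^sub>1 * (r * t)) + x * \<epsilon>\<^sub>1 * N"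
    unfolding R by (simp add: algebra_simps)
  ultimately have "1720 * (x * \<epsilon>\<^sub>1 * R) \<le> (x * \<epsilon>\<^sub>2)\<^sup>2"
    using zero_le_power2[of "x * \<epsilon>\<^sub>2"] by linarith
  then show "860 * (x * \<epsilon>\<^sub>1) \<le> (x * \<epsilon>\<^sub>2)\<^sup>2 / (2 * R)"
    using Rpos by (simp add: le_divide_eq mult_ac)
qed

text \<open>Each condition comes from one summand of the sample bound: the first two from the
  \<open>sqrt N\<close> term, the third from the \<open>powr\<close> term, the fourth from the
  quadratic and the fifth from the linear term in \<open>\<epsilon>\<^sub>1\<close>. The constant is
  squared so that 50000 survives taking a square root.\<close>

lemma sample_size_conditions:
  fixes x N \<epsilon>\<^sub>1 \<epsilon>\<^sub>2 :: real
  assumes N: "1 \<le> N" and \<epsilon>: "0 < \<epsilon>\<^sub>2" "\<epsilon>\<^sub>2 \<le> 1" "0 \<le> \<epsilon>\<^sub>1"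
    and x: "50000\<^sup>2 * (N * (\<epsilon>\<^sub>1 / \<epsilon>\<^sub>2 ^ 2) ^ 2 + N * (\<epsilon>\<^sub>1 / \<epsilon>\<^sub>2 ^ 2)
      + sqrt N / \<epsilon>\<^sub>2 ^ 2 + N powr (2/3) / \<epsilon>\<^sub>2 powr (4/3)) \<le> x"
  shows "50000 \<le> sqrt x * \<epsilon>\<^sub>2" "50000 * sqrt N \<le> x * \<epsilon>\<^sub>2\<^sup>2"
    "50000 * N \<le> x * sqrt x * \<epsilon>\<^sub>2\<^sup>2"
    "50000 * (sqrt N * \<epsilon>\<^sub>1) \<le> sqrt x * \<epsilon>\<^sub>2\<^sup>2" "50000 * (N * \<epsilon>\<^sub>1) \<le> x * \<epsilon>\<^sub>2\<^sup>2"
proof -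
  let ?K = "50000 :: real"
  have nn: "0 \<le> N * (\<epsilon>\<^sub>1 / \<epsilon>\<^sub>2 ^ 2) ^ 2" "0 \<le> N * (\<epsilon>\<^sub>1 / \<epsilon>\<^sub>2 ^ 2)" "0 \<le> sqrt N / \<epsilon>\<^sub>2 ^ 2"
    "0 \<le> N powr (2/3) / \<epsilon>\<^sub>2 powr (4/3)"
    using N \<epsilon> by auto
  have le: "?K\<^sup>2 * t \<le> x" if "t \<le> N * (\<epsilon>\<^sub>1 / \<epsilon>\<^sub>2 ^ 2) ^ 2 + N * (\<epsilon>\<^sub>1 / \<epsilon>\<^sub>2 ^ 2)
      + sqrt N / \<epsilon>\<^sub>2 ^ 2 + N powr (2/3) / \<epsilon>\<^sub>2 powr (4/3)" for t
    by (rule order_trans[OF mult_left_mono[OF that] x]) simp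
  have a: "?K\<^sup>2 * (N * (\<epsilon>\<^sub>1 / \<epsilon>\<^sub>2 ^ 2) ^ 2) \<le> x" by (rule le) (use nn in linarith)
  have b: "?K\<^sup>2 * (N * (\<epsilon>\<^sub>1 / \<epsilon>\<^sub>2 ^ 2)) \<le> x" by (rule le) (use nn in linarith)
  have c: "?K\<^sup>2 * (sqrt N / \<epsilon>\<^sub>2 ^ 2) \<le> x" by (rule le) (use nn in linarith)
  have e: "?K\<^sup>2 * (N powr (2/3) / \<epsilon>\<^sub>2 powr (4/3)) \<le> x" by (rule le) (use nn in linarith)
  have x0: "0 \<le> x" using c nn(3) by (simp add: power2_eq_square)
  have c': "?K\<^sup>2 * sqrt N \<le> x * \<epsilon>\<^sub>2\<^sup>2" using c \<epsilon> by (simp add: field_simps)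
  have N1: "1 \<le> sqrt N" using N by simp
  show "?K * sqrt N \<le> x * \<epsilon>\<^sub>2\<^sup>2" using c' N1 unfolding power2_eq_square[of ?K] by linarith
  have "?K\<^sup>2 * 1 \<le> x * \<epsilon>\<^sub>2\<^sup>2" using c' N1 unfolding power2_eq_square[of ?K] by linarith
  then have "sqrt (?K\<^sup>2) \<le> sqrt (x * \<epsilon>\<^sub>2\<^sup>2)" by (intro real_sqrt_le_mono) simp
  then show "?K \<le> sqrt x * \<epsilon>\<^sub>2" using \<epsilon> by (simp add: real_sqrt_mult)
  have "?K\<^sup>2 * (N * \<epsilon>\<^sub>1) \<le> x * \<epsilon>\<^sub>2\<^sup>2" using b \<epsilon> by (simp add: field_simps)
  moreover have "0 \<le> N * \<epsilon>\<^sub>1" using N \<epsilon> by simp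
  ultimately show "?K * (N * \<epsilon>\<^sub>1) \<le> x * \<epsilon>\<^sub>2\<^sup>2" unfolding power2_eq_square[of ?K] by linarith
  have "sqrt (?K\<^sup>2 * (N * (\<epsilon>\<^sub>1 / \<epsilon>\<^sub>2 ^ 2) ^ 2)) \<le> sqrt x" using a by (rule real_sqrt_le_mono)
  then have "?K * (sqrt N * (\<epsilon>\<^sub>1 / \<epsilon>\<^sub>2 ^ 2)) \<le> sqrt x"
    unfolding real_sqrt_mult real_sqrt_abs using \<epsilon> by simp
  then show "?K * (sqrt N * \<epsilon>\<^sub>1) \<le> sqrt x * \<epsilon>\<^sub>2\<^sup>2" using \<epsilon> by (simp add: field_simps)
  \<comment> \<open>The exponent 3/2 turns N^(2/3) / e^(4/3) into N / e^2 (with e for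
    \<open>\<epsilon>\<^sub>2\<close>) and \<open>x\<close> into \<open>x * sqrt x\<close>.\<close>
  have "(?K\<^sup>2 * (N powr (2/3) / \<epsilon>\<^sub>2 powr (4/3))) powr (3/2) \<le> x powr (3/2)"
    using e nn(4) by (intro powr_mono2) auto
  moreover have "(?K\<^sup>2 * (N powr (2/3) / \<epsilon>\<^sub>2 powr (4/3))) powr (3/2) = ?K ^ 3 * (N / \<epsilon>\<^sub>2\<^sup>2)"
  proof -
    have "(?K\<^sup>2) powr (3/2) = ?K powr (2 * (3/2))"
      unfolding powr_powr[symmetric] by simp
    also have "\<dots> = ?K ^ 3" using powr_realpow[of ?K 3] by simp
    finally have "(?K\<^sup>2) powr (3/2) = ?K ^ 3" .
    moreover have "\<epsilon>\<^sub>2 powr 2 = \<epsilon>\<^sub>2\<^sup>2" using \<epsilon> powr_realpow[of \<epsilon>\<^sub>2 2] by simp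
    ultimately show ?thesis
      using N \<epsilon> nn(4) by (simp only: powr_mult powr_divide powr_powr) simp
  qed
  moreover have "x powr (3/2) = x * sqrt x"
  proof -
    have "x powr (3/2) = x powr (1 + 1/2)" by simp
    then show ?thesis using x0 by (cases "x = 0") (simp_all only: powr_add powr_half_sqrt, auto)
  qed
  ultimately have "?K ^ 3 * (N / \<epsilon>\<^sub>2\<^sup>2) \<le> x * sqrt x" by simp
  then have "?K ^ 3 * N \<le> x * sqrt x * \<epsilon>\<^sub>2\<^sup>2" using \<epsilon> by (simp add: field_simps)
  then show "?K * N \<le> x * sqrt x * \<epsilon>\<^sub>2\<^sup>2" using N by simp
qed

section \<open>Correctness of the tester and choice of the absolute constants\<close>

lemma closeness_tester_correct:
  fixes n k :: nat and \<epsilon>\<^sub>1 \<epsilon>\<^sub>2 :: real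
  defines "\<tau> \<equiv> (real k * \<epsilon>\<^sub>2)\<^sup>2 / (2 * (real k * \<epsilon>\<^sub>2 + 9 * sqrt (real k * real n) + real n))"
  assumes pq: "dist_on n p" "dist_on n q" and nk: "1 \<le> n" "0 < k" and \<epsilon>: "0 < \<epsilon>\<^sub>2"
    and bounds: "860 * (real k * \<epsilon>\<^sub>1) \<le> \<tau>" "90240 * real k \<le> \<tau>\<^sup>2"
  shows "l1_dist n p q \<le> \<epsilon>\<^sub>1 \<Longrightarrow>
      pmf (run_tester (k + k + (k + k)) (closeness_tester n k \<tau>) p q) False \<ge> 4/5"
    and "l1_dist n p q \<ge> \<epsilon>\<^sub>2 \<Longrightarrow>
      pmf (run_tester (k + k + (k + k)) (closeness_tester n k \<tau>) p q) True \<ge> 4/5"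
proof -
  interpret two_sample n k p q by unfold_locales (rule pq)+
  let ?J = "pair_pmf (pair_pmf P P) (pair_pmf P P)"
  let ?run = "run_tester (k + k + (k + k)) (closeness_tester n k \<tau>) p q"
  have run: "?run = map_pmf (\<lambda>(g, h). \<tau> < stat n k g h) ?J"
    unfolding run_closeness_tester P_def Let_def ..
  have \<tau>0: "0 < \<tau>"
    unfolding \<tau>_def using nk \<epsilon> by (intro divide_pos_pos mult_pos_pos zero_less_power add_nonneg_pos) auto
  have "pmf ?run True = measure_pmf.prob ?J {(g, h). \<tau> < stat n k g h}"
    "pmf ?run False = measure_pmf.prob ?J {(g, h). \<not> \<tau> < stat n k g h}"
    unfolding run pmf_map by (intro arg_cong[where f = "measure_pmf.prob ?J"]; auto)+
  \<comment> \<open>The two output probabilities add up to 1, so it suffices to bound the wrong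
    output by 1/5.\<close>
  moreover have "pmf ?run True + pmf ?run False = 1"
  proof -
    have "sum (pmf ?run) UNIV = 1" by (rule sum_pmf_eq_1) auto
    then show ?thesis unfolding UNIV_bool by simp
  qed
  moreover have "measure_pmf.prob ?J {(g, h). \<tau> < stat n k g h} \<le> 1/5" if "l1_dist n p q \<le> \<epsilon>\<^sub>1"
  proof (rule stat_not_large_if_close[OF \<tau>0 _ bounds(2)])
    have "real k * l1_dist n p q \<le> real k * \<epsilon>\<^sub>1" using that by (intro mult_left_mono) auto
    then show "860 * (real k * l1_dist n p q) \<le> \<tau>" using bounds(1) by linarith
  qed
  moreover have "measure_pmf.prob ?J {(g, h). \<not> \<tau> < stat n k g h} \<le> 1/5" if "l1_dist n p q \<ge> \<epsilon>\<^sub>2"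
    using that \<epsilon> nk by (intro stat_large_if_far[OF \<tau>0 bounds(2), of \<epsilon>\<^sub>2]) (auto simp: \<tau>_def)
  ultimately show "l1_dist n p q \<le> \<epsilon>\<^sub>1 \<Longrightarrow> pmf ?run False \<ge> 4/5" "l1_dist n p q \<ge> \<epsilon>\<^sub>2 \<Longrightarrow> pmf ?run True \<ge> 4/5"
    by fastforce+
qed

theorem theorem2p2:
  shows "\<exists>c::real. c > 0 \<and> (\<exists>C::real. C > 0 \<and>
    (\<forall>(n::nat) (\<epsilon>\<^sub>1::real) (\<epsilon>\<^sub>2::real).
       n \<ge> 1 \<and> 0 < \<epsilon>\<^sub>2 \<and> \<epsilon>\<^sub>2 \<le> 1 \<and> 0 \<le> \<epsilon>\<^sub>1 \<and> \<epsilon>\<^sub>1 \<le> c * \<epsilon>\<^sub>2 \<longrightarrow>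
       (\<exists>(m::nat) T.
          real m \<le> C * (real n * (\<epsilon>\<^sub>1 / \<epsilon>\<^sub>2 ^ 2) ^ 2 + real n * (\<epsilon>\<^sub>1 / \<epsilon>\<^sub>2 ^ 2)
                         + sqrt (real n) / \<epsilon>\<^sub>2 ^ 2
                         + real n powr (2/3) / \<epsilon>\<^sub>2 powr (4/3)) \<and>
          (\<forall>p q. dist_on n p \<and> dist_on n q \<longrightarrow>
             (l1_dist n p q \<le> \<epsilon>\<^sub>1 \<longrightarrow> pmf (run_tester m T p q) False \<ge> 4/5) \<and>
             (l1_dist n p q \<ge> \<epsilon>\<^sub>2 \<longrightarrow> pmf (run_tester m T p q) True \<ge> 4/5)))))"
proof (rule exI[of _ "1 / 50000"], rule conjI, simp, rule exI[of _ "8 * 50000\<^sup>2"], rule conjI, simp,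
    intro allI impI, elim conjE)
  fix n :: nat and \<epsilon>\<^sub>1 \<epsilon>\<^sub>2 :: real
  assume n: "1 \<le> n" and \<epsilon>: "0 < \<epsilon>\<^sub>2" "\<epsilon>\<^sub>2 \<le> 1" "0 \<le> \<epsilon>\<^sub>1" and gap: "\<epsilon>\<^sub>1 \<le> 1 / 50000 * \<epsilon>\<^sub>2"
  define S where "S = real n * (\<epsilon>\<^sub>1 / \<epsilon>\<^sub>2 ^ 2) ^ 2 + real n * (\<epsilon>\<^sub>1 / \<epsilon>\<^sub>2 ^ 2)
    + sqrt (real n) / \<epsilon>\<^sub>2 ^ 2 + real n powr (2/3) / \<epsilon>\<^sub>2 powr (4/3)"
  define k where "k = nat \<lceil>50000\<^sup>2 * S\<rceil>"
  define \<tau> where "\<tau> = (real k * \<epsilon>\<^sub>2)\<^sup>2 / (2 * (real k * \<epsilon>\<^sub>2 + 9 * sqrt (real k * real n) + real n))"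
  have "1 \<le> sqrt (real n)" using n by simp
  also have "\<dots> \<le> sqrt (real n) / \<epsilon>\<^sub>2 ^ 2"
    using \<epsilon> by (simp add: le_divide_eq mult_left_le power_le_one)
  also have "\<dots> \<le> S"
    unfolding S_def using \<epsilon> by (simp add: add_nonneg_nonneg)
  finally have S: "1 \<le> S" .
  have k: "50000\<^sup>2 * S \<le> real k" "real k \<le> 50000\<^sup>2 * S + 1"
  proof -
    have "0 \<le> 50000\<^sup>2 * S" using S by simp
    then show "50000\<^sup>2 * S \<le> real k" "real k \<le> 50000\<^sup>2 * S + 1"
      unfolding k_def by linarith+
  qed
  then have kpos: "0 < k" using S by (cases k) auto
  \<comment> \<open>Rounding up costs at most 1, which \<open>S\<close> absorbs: each of the four
    batches has size at most 2 * 50000^2 * S, whence the factor 8.\<close>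
  have m: "real (k + k + (k + k)) \<le> 8 * 50000\<^sup>2 * S"
    using k(2) S by simp
  have "1 \<le> real n" using n by simp
  note conds = sample_size_conditions[OF this \<epsilon> k(1)[unfolded S_def]]
  \<comment> \<open>The choice c = 1 / 50000 supplies the one condition of
    \<open>threshold_bounds\<close> that does not involve the sample size.\<close>
  have "0 < real k" "0 < real n" "50000 * \<epsilon>\<^sub>1 \<le> \<epsilon>\<^sub>2" using kpos n gap by simp_all
  note bounds = threshold_bounds[OF this(1,2) \<epsilon>(1,3) conds(1-3) this(3) conds(4,5), folded \<tau>_def]
  show "\<exists>m T. real m \<le> 8 * 50000\<^sup>2 * (real n * (\<epsilon>\<^sub>1 / \<epsilon>\<^sub>2 ^ 2) ^ 2 + real n * (\<epsilon>\<^sub>1 / \<epsilon>\<^sub>2 ^ 2)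
        + sqrt (real n) / \<epsilon>\<^sub>2 ^ 2 + real n powr (2/3) / \<epsilon>\<^sub>2 powr (4/3)) \<and>
      (\<forall>p q. dist_on n p \<and> dist_on n q \<longrightarrow>
        (l1_dist n p q \<le> \<epsilon>\<^sub>1 \<longrightarrow> pmf (run_tester m T p q) False \<ge> 4/5) \<and>
        (l1_dist n p q \<ge> \<epsilon>\<^sub>2 \<longrightarrow> pmf (run_tester m T p q) True \<ge> 4/5))"
  proof (intro exI conjI allI impI; (elim conjE)?)
    show "real (k + k + (k + k)) \<le> 8 * 50000\<^sup>2 * (real n * (\<epsilon>\<^sub>1 / \<epsilon>\<^sub>2 ^ 2) ^ 2 + real n * (\<epsilon>\<^sub>1 / \<epsilon>\<^sub>2 ^ 2)
        + sqrt (real n) / \<epsilon>\<^sub>2 ^ 2 + real n powr (2/3) / \<epsilon>\<^sub>2 powr (4/3))"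
      using m unfolding S_def .
    fix p q assume "dist_on n p" "dist_on n q"
    note correct = closeness_tester_correct[OF this n kpos \<epsilon>(1), of \<epsilon>\<^sub>1, folded \<tau>_def, OF bounds]
    show "pmf (run_tester (k + k + (k + k)) (closeness_tester n k \<tau>) p q) False \<ge> 4/5"
      if "l1_dist n p q \<le> \<epsilon>\<^sub>1" using that by (rule correct(1))
    show "pmf (run_tester (k + k + (k + k)) (closeness_tester n k \<tau>) p q) True \<ge> 4/5"
      if "l1_dist n p q \<ge> \<epsilon>\<^sub>2" using that by (rule correct(2))
  qed
qed

end
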